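(* Let $\{(x_i,y_i)\}_{i=1}^6\subset\mathbb{P}^2\times\mathbb{P}^2$ and suppose that $y_1,\dots,y_6$ are in a line. Let $Z_6$ be the $6\times9$ matrix with rows $x_i^\top\otimes y_i^\top$. Then $Z_6$ is rank deficient (i.e. $\operatorname{rank}(Z_6)<6$) if and only if $$\bar a_xA_y+\bar b_xB_y+\bar c_xC_y+\bar d_xD_y+\bar e_xE_y+\bar f_xF_y=0.$$ Furthermore, if $x_1,\dots,x_6$ are in general position and $y_1,\dots,y_6$ are distinct, then this equation holds if and only if there exists a projection $T:\mathbb{P}^2\to\mathbb{P}^1$ (from the plane containing the $x_i$ to the line containing the $y_i$, identified with $\mathbb{P}^1$) such that $T(x_i)\sim y_i$ for all $i$.
   Context: $\mathbb{P}^n$ is projective space over $\mathbb{C}$; points are represented by nonzero column vectors, $\otimes$ is the Kronecker product, and $\sim$ means equal up to a nonzero scalar. Six points in $\mathbb{P}^2$ are in general position if at most $2$ of them are in a line and at most $5$ of them are on a conic. A projection $T:\mathbb{P}^2\to\mathbb{P}^1$ is the (rational) map given by a rank $2$ matrix of size $2\times 3$; its center is the point spanning the null space. For $p_1,\dots,p_6\in\mathbb{P}^2$, $[ijl]$ is the determinant of the $3\times3$ matrix with rows $p_i^\top,p_j^\top,p_l^\top$, and $[(ij)(kl)(rs)]:=[ijr][kls]-[ijs][klr]$. Define $$\begin{aligned} \bar a&=[(25)(13)(46)]+[(51)(42)(36)]+[(14)(35)(26)]+[(43)(21)(56)]+[(32)(54)(16)]\\ \bar b&=[(53)(12)(46)]+[(14)(23)(56)]+[(25)(34)(16)]+[(31)(45)(26)]+[(42)(51)(36)]\\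 \bar c&=[(53)(41)(26)]+[(34)(25)(16)]+[(42)(13)(56)]+[(21)(54)(36)]+[(15)(32)(46)]\\ \bar d&=[(45)(31)(26)]+[(53)(24)(16)]+[(41)(25)(36)]+[(32)(15)(46)]+[(21)(43)(56)]\\ \bar e&=[(31)(24)(56)]+[(12)(53)(46)]+[(25)(41)(36)]+[(54)(32)(16)]+[(43)(15)(26)]\\ \bar f&=[(42)(35)(16)]+[(23)(14)(56)]+[(31)(52)(46)]+[(15)(43)(26)]+[(54)(21)(36)] \end{aligned}$$ and let $\bar a_x,\dots,\bar f_x$ be their values at $p_i=x_i$. For the collinear points $y_i$, identify their line with $\mathbb{P}^1$ (apply a homography taking the line to $\{( *,*,0)\}$ and drop the $0$ coordinate) and let $[ij]$ be the $2\times2$ determinant with rows $y_i^\top,y_j^\top$. The Joubert invariants are $$\begin{aligned} A_y&=[25][13][46]+[51][42][36]+[14][35][26]+[43][21][56]+[32][54][16]\\ B_y&=[53][12][46]+[14][23][56]+[25][34][16]+[31][45][26]+[42][51][36]\\ C_y&=[53][41][26]+[34][25][16]+[42][13][56]+[21][54][36]+[15][32][46]\\ D_y&=[45][31][26]+[53][24][16]+[41][25][36]+[32][15][46]+[21][43][56]\\ E_y&=[31][24][56]+[12][53][46]+[25][41][36]+[54][32][16]+[43][15][26]\\ F_y&=[42][35][16]+[23][14][56]+[31][52][46]+[15][43][26]+[54][21][36] \end{aligned}$$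
   Formalization: The condition T(x_i) ~ y_i is required only for those x_i that are not the center of T, where the rational map T is defined; if T had to be defined at every x_i, the equation would not always imply that T exists. *)

theory Defs
  imports "HOL-Analysis.Analysis"
begin

text \<open>
  A point of the complex projective space is represented by a nonzero vector. Six labelled
  points are a function on the numeral type 6, whose elements are 1, ..., 6 (with 6 = 0).
\<close>

definition proj_eq :: "complex^'n \<Rightarrow> complex^'n \<Rightarrow> bool"  (infix \<open>\<sim>\<^sub>P\<close> 50)
  where "v \<sim>\<^sub>P w \<longleftrightarrow> (\<exists>c. c \<noteq> 0 \<and> v = c *s w)"

text \<open>
  The columns of the matrix \<open>Z\<close> are indexed by the 9 pairs in \<open>3 \<times> 3\<close>; entry \<open>(j, k)\<close> of the
  Kronecker product \<open>v \<otimes> w\<close> is \<open>v\<^sub>j w\<^sub>k\<close>.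
\<close>

definition kronecker :: "complex^'m \<Rightarrow> complex^'n \<Rightarrow> complex^('m \<times> 'n)"
  where "kronecker v w = (\<chi> jk. v $ fst jk * w $ snd jk)"

definition Z_matrix :: "(6 \<Rightarrow> complex^3) \<Rightarrow> (6 \<Rightarrow> complex^3) \<Rightarrow> complex^(3 \<times> 3)^6"
  where "Z_matrix x y = (\<chi> i. kronecker (x i) (y i))"

text \<open>
  The bilinear product, without conjugation: the library's inner product on \<open>complex^'n\<close> is
  the real one and does not give the linear forms needed here.
\<close>

definition dotp :: "complex^'n \<Rightarrow> complex^'n \<Rightarrow> complex"
  where "dotp v w = (\<Sum>k\<in>UNIV. v $ k * w $ k)"

text \<open>The line of the plane with coefficient vector \<open>w \<noteq> 0\<close>, as a linear subspace.\<close>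

definition line :: "complex^3 \<Rightarrow> (complex^3) set"
  where "line w = {v. dotp w v = 0}"

text \<open>The conic with symmetric coefficient matrix \<open>Q \<noteq> 0\<close>, possibly degenerate.\<close>

definition plane_conic :: "complex^3^3 \<Rightarrow> (complex^3) set"
  where "plane_conic Q = {v. dotp v (Q *v v) = 0}"

definition general_position :: "(6 \<Rightarrow> complex^3) \<Rightarrow> bool"
  where "general_position p \<longleftrightarrow>
    (\<forall>w. w \<noteq> 0 \<longrightarrow> card {i. p i \<in> line w} \<le> 2) \<and>
    (\<forall>Q. transpose Q = Q \<and> Q \<noteq> 0 \<longrightarrow> card {i. p i \<in> plane_conic Q} \<le> 5)"

text \<open>
  \<open>H\<close> is the matrix of a homography taking the given line to \<open>{(*, *, 0)}\<close>; the resulting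
  identification of that line with \<open>\<P>\<^sup>1\<close> drops the last coordinate.
\<close>

definition line_homography :: "complex^3 \<Rightarrow> complex^3^3 \<Rightarrow> bool"
  where "line_homography w H \<longleftrightarrow> invertible H \<and> ((*v) H) ` line w = {v. v $ 3 = 0}"

definition to_P1 :: "complex^3^3 \<Rightarrow> complex^3 \<Rightarrow> complex^2"
  where "to_P1 H v = vector [(H *v v) $ 1, (H *v v) $ 2]"

lemma line_homography_exists:
  assumes "w \<noteq> 0"
  shows "\<exists>H. line_homography w H"
proof -
  have hom: "line_homography w H" if H: "det H \<noteq> 0" "\<And>v. (H *v v) $ 3 = dotp w v" for H
  proof -
    have inv: "invertible H" using H(1) by (simp add: invertible_det_nz)
    then obtain B where B: "H ** B = mat 1" unfolding invertible_def by blast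
    have "v \<in> ((*v) H) ` line w" if v: "v $ 3 = 0" for v
    proof (rule image_eqI)
      show e: "v = H *v (B *v v)" by (simp add: matrix_vector_mul_assoc B)
      show "B *v v \<in> line w" unfolding line_def mem_Collect_eq H(2)[symmetric] e[symmetric]
        by (rule v)
    qed
    moreover have "v $ 3 = 0" if "v \<in> ((*v) H) ` line w" for v
      using that unfolding line_def by (auto simp only: H(2) image_iff mem_Collect_eq)
    ultimately have "((*v) H) ` line w = {v. v $ 3 = 0}" by blast
    with inv show ?thesis unfolding line_homography_def by blast
  qed
  define H :: "3 \<Rightarrow> 3 \<Rightarrow> complex^3^3" where "H = (\<lambda>a b. vector [axis a 1, axis b 1, w])"
  have d: "(H a b *v v) $ 3 = dotp w v" for a b v
    by (simp only: H_def matrix_vector_mult_def dotp_def vec_lambda_beta vector_3)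
  have det: "det (H 2 3) = w $ 1" "det (H 1 3) = - w $ 2" "det (H 1 2) = w $ 3"
    by (simp_all add: H_def det_3 axis_def)
  have "w $ 1 \<noteq> 0 \<or> w $ 2 \<noteq> 0 \<or> w $ 3 \<noteq> 0"
    using assms unfolding vec_eq_iff forall_3 zero_index by blast
  then obtain a b where "det (H a b) \<noteq> 0" using det by (metis neg_equal_0_iff_equal)
  then show ?thesis using hom d by blast
qed

definition projection :: "complex^3^2 \<Rightarrow> bool"
  where "projection T \<longleftrightarrow> rank T = 2"

definition is_center :: "complex^3^2 \<Rightarrow> complex^3 \<Rightarrow> bool"
  where "is_center T c \<longleftrightarrow> {v. T *v v = 0} = vec.span {c}"

text \<open>
  The rational map given by \<open>T\<close> is defined at \<open>v\<close> exactly when \<open>v\<close> is not its center. The map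
  \<open>T\<close> sends \<open>x\<^sub>i\<close> to \<open>u\<^sub>i\<close> for all \<open>i\<close> as a rational map, that is, wherever it is defined (at most
  one \<open>x\<^sub>i\<close> is exempt if the \<open>x\<^sub>i\<close> are distinct points).
\<close>

definition maps_points :: "complex^3^2 \<Rightarrow> (6 \<Rightarrow> complex^3) \<Rightarrow> (6 \<Rightarrow> complex^2) \<Rightarrow> bool"
  where "maps_points T x u \<longleftrightarrow> (\<forall>i. \<not> is_center T (x i) \<longrightarrow> T *v x i \<sim>\<^sub>P u i)"

definition br3 :: "(6 \<Rightarrow> complex^3) \<Rightarrow> 6 \<Rightarrow> 6 \<Rightarrow> 6 \<Rightarrow> complex"
  where "br3 p i j l = det (vector [p i, p j, p l] :: complex^3^3)"

definition br33 :: "(6 \<Rightarrow> complex^3) \<Rightarrow> 6 \<Rightarrow> 6 \<Rightarrow> 6 \<Rightarrow> 6 \<Rightarrow> 6 \<Rightarrow> 6 \<Rightarrow> complex"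
  where "br33 p i j k l r s = br3 p i j r * br3 p k l s - br3 p i j s * br3 p k l r"

definition br2 :: "(6 \<Rightarrow> complex^2) \<Rightarrow> 6 \<Rightarrow> 6 \<Rightarrow> complex"
  where "br2 u i j = det (vector [u i, u j] :: complex^2^2)"

definition bar_a :: "(6 \<Rightarrow> complex^3) \<Rightarrow> complex"
  where "bar_a p =
    br33 p 2 5 1 3 4 6 +
    br33 p 5 1 4 2 3 6 +
    br33 p 1 4 3 5 2 6 +
    br33 p 4 3 2 1 5 6 +
    br33 p 3 2 5 4 1 6"

definition bar_b :: "(6 \<Rightarrow> complex^3) \<Rightarrow> complex"
  where "bar_b p =
    br33 p 5 3 1 2 4 6 +
    br33 p 1 4 2 3 5 6 +
    br33 p 2 5 3 4 1 6 +
    br33 p 3 1 4 5 2 6 +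
    br33 p 4 2 5 1 3 6"

definition bar_c :: "(6 \<Rightarrow> complex^3) \<Rightarrow> complex"
  where "bar_c p =
    br33 p 5 3 4 1 2 6 +
    br33 p 3 4 2 5 1 6 +
    br33 p 4 2 1 3 5 6 +
    br33 p 2 1 5 4 3 6 +
    br33 p 1 5 3 2 4 6"

definition bar_d :: "(6 \<Rightarrow> complex^3) \<Rightarrow> complex"
  where "bar_d p =
    br33 p 4 5 3 1 2 6 +
    br33 p 5 3 2 4 1 6 +
    br33 p 4 1 2 5 3 6 +
    br33 p 3 2 1 5 4 6 +
    br33 p 2 1 4 3 5 6"

definition bar_e :: "(6 \<Rightarrow> complex^3) \<Rightarrow> complex"
  where "bar_e p =
    br33 p 3 1 2 4 5 6 +
    br33 p 1 2 5 3 4 6 +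
    br33 p 2 5 4 1 3 6 +
    br33 p 5 4 3 2 1 6 +
    br33 p 4 3 1 5 2 6"

definition bar_f :: "(6 \<Rightarrow> complex^3) \<Rightarrow> complex"
  where "bar_f p =
    br33 p 4 2 3 5 1 6 +
    br33 p 2 3 1 4 5 6 +
    br33 p 3 1 5 2 4 6 +
    br33 p 1 5 4 3 2 6 +
    br33 p 5 4 2 1 3 6"

definition joubert_A :: "(6 \<Rightarrow> complex^2) \<Rightarrow> complex"
  where "joubert_A u =
    br2 u 2 5 * br2 u 1 3 * br2 u 4 6 +
    br2 u 5 1 * br2 u 4 2 * br2 u 3 6 +
    br2 u 1 4 * br2 u 3 5 * br2 u 2 6 +
    br2 u 4 3 * br2 u 2 1 * br2 u 5 6 +
    br2 u 3 2 * br2 u 5 4 * br2 u 1 6"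

definition joubert_B :: "(6 \<Rightarrow> complex^2) \<Rightarrow> complex"
  where "joubert_B u =
    br2 u 5 3 * br2 u 1 2 * br2 u 4 6 +
    br2 u 1 4 * br2 u 2 3 * br2 u 5 6 +
    br2 u 2 5 * br2 u 3 4 * br2 u 1 6 +
    br2 u 3 1 * br2 u 4 5 * br2 u 2 6 +
    br2 u 4 2 * br2 u 5 1 * br2 u 3 6"

definition joubert_C :: "(6 \<Rightarrow> complex^2) \<Rightarrow> complex"
  where "joubert_C u =
    br2 u 5 3 * br2 u 4 1 * br2 u 2 6 +
    br2 u 3 4 * br2 u 2 5 * br2 u 1 6 +
    br2 u 4 2 * br2 u 1 3 * br2 u 5 6 +
    br2 u 2 1 * br2 u 5 4 * br2 u 3 6 +
    br2 u 1 5 * br2 u 3 2 * br2 u 4 6"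

definition joubert_D :: "(6 \<Rightarrow> complex^2) \<Rightarrow> complex"
  where "joubert_D u =
    br2 u 4 5 * br2 u 3 1 * br2 u 2 6 +
    br2 u 5 3 * br2 u 2 4 * br2 u 1 6 +
    br2 u 4 1 * br2 u 2 5 * br2 u 3 6 +
    br2 u 3 2 * br2 u 1 5 * br2 u 4 6 +
    br2 u 2 1 * br2 u 4 3 * br2 u 5 6"

definition joubert_E :: "(6 \<Rightarrow> complex^2) \<Rightarrow> complex"
  where "joubert_E u =
    br2 u 3 1 * br2 u 2 4 * br2 u 5 6 +
    br2 u 1 2 * br2 u 5 3 * br2 u 4 6 +
    br2 u 2 5 * br2 u 4 1 * br2 u 3 6 +
    br2 u 5 4 * br2 u 3 2 * br2 u 1 6 +
    br2 u 4 3 * br2 u 1 5 * br2 u 2 6"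

definition joubert_F :: "(6 \<Rightarrow> complex^2) \<Rightarrow> complex"
  where "joubert_F u =
    br2 u 4 2 * br2 u 3 5 * br2 u 1 6 +
    br2 u 2 3 * br2 u 1 4 * br2 u 5 6 +
    br2 u 3 1 * br2 u 5 2 * br2 u 4 6 +
    br2 u 1 5 * br2 u 4 3 * br2 u 2 6 +
    br2 u 5 4 * br2 u 2 1 * br2 u 3 6"

end

theory Submission
  imports "Jordan_Normal_Form.Determinant" Defs
begin

text \<open>
  The points \<open>y\<^sub>i\<close> lie in a plane of \<open>\<complex>\<^sup>3\<close>, so the nine columns of \<open>Z\<close> carry no more information
  than the six columns of the square matrix with rows \<open>u\<^sub>i \<otimes> x\<^sub>i\<close>. Hence \<open>Z\<close> is rank deficient iff
  the determinant of that matrix vanishes (\<open>rank_Z_less_iff\<close>), and the first claim reduces to the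
  polynomial identity \<open>bar_a x * joubert_A u + \<dots> + bar_f x * joubert_F u = 24 * kron_det x u\<close>
  (\<open>bar_joubert_sum_eq\<close>).

  The identity is proved by comparing both sides in one basis. Laplace expansion along the three
  columns with factor \<open>u\<^sub>i\<^sub>1\<close> writes the determinant as a combination of the ten products \<open>[ijk][lmn]\<close>
  of complementary brackets of the \<open>x\<^sub>i\<close>, and each \<open>bar\<close> is such a combination by definition. The
  Pluecker relations reduce the ten products to five standard ones. On the determinant side their
  coefficients turn out to be, up to sign, products of brackets \<open>[ij][kl][mn]\<close> of the \<open>u\<^sub>i\<close> (one of
  them a sum of two such products, \<open>kron_det_standard\<close>). On the other side they are integer
  combinations of the six Joubert invariants, and these are 24 times the same products
  (\<open>bar_standard\<close>, \<open>joubert_dual\<close>).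

  For the projection, a vector in the kernel of the square matrix is, after turning the two
  coordinates of \<open>\<complex>\<^sup>2\<close> by a right angle, a nonzero \<open>2 \<times> 3\<close> matrix \<open>T\<close> with \<open>T x\<^sub>i\<close> in the span of
  \<open>u\<^sub>i\<close> for all \<open>i\<close>. Every projection of the required kind is such a matrix. Conversely, a \<open>T\<close> of
  rank 1 has a one-dimensional image, which contains at most one of the distinct points \<open>u\<^sub>i\<close>; at
  least five of the \<open>x\<^sub>i\<close> would lie in the kernel of \<open>T\<close>, that is, on a line, against general
  position. So \<open>T\<close> has rank 2 and is the required projection (\<open>kron_det_eq_0_iff_projection\<close>).
\<close>

no_notation Matrix.vec_index (infixl \<open>$\<close> 100)

section \<open>Minors indexed by lists\<close>

text \<open>
  Rows and columns are arbitrary index lists, so that Laplace expansion removes entries from the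
  lists instead of renumbering the rows and columns that remain. The value is meant for lists of equal
  length.
\<close>

definition minor :: "('i \<Rightarrow> 'j \<Rightarrow> 'a::comm_ring_1) \<Rightarrow> 'i list \<Rightarrow> 'j list \<Rightarrow> 'a"
  where "minor g is js =
    Determinant.det (Matrix.mat (length is) (length is) (\<lambda>(k, l). g (is ! k) (js ! l)))"

lemma minor_Nil: "minor g [] [] = 1"
  by (simp add: minor_def)

lemma minor_swap:
  assumes "length is = length js"
  shows "minor g is js = minor (\<lambda>j i. g i j) js is"
proof -
  have "minor (\<lambda>j i. g i j) js is =
      Determinant.det (transpose_mat (Matrix.mat (length is) (length is) (\<lambda>(k, l). g (is ! k) (js ! l))))"
    unfolding minor_def by (intro arg_cong[of _ _ Determinant.det] eq_matI) (use assms in auto)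
  also have "\<dots> = minor g is js"
    by (subst Determinant.det_transpose[of _ "length is"]) (auto simp: minor_def)
  finally show ?thesis ..
qed

lemma minor_expand:
  assumes len: "length is = Suc (length js)"
  shows "minor g is (j # js) =
    (\<Sum>k<length is. (-1)^k * g (is ! k) j * minor g (take k is @ drop (Suc k) is) js)"
proof -
  define n where "n = length js"
  define A where "A = Matrix.mat (Suc n) (Suc n) (\<lambda>(k, l). g (is ! k) ((j # js) ! l))"
  have A: "A \<in> carrier_mat (Suc n) (Suc n)" by (simp add: A_def)
  have del: "mat_delete A k 0 =
      Matrix.mat n n (\<lambda>(i, l). g ((take k is @ drop (Suc k) is) ! i) (js ! l))"
    if k: "k < Suc n" for k
    by (rule eq_matI) (use k in \<open>auto simp: A_def mat_delete_def nth_append n_def len\<close>)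
  have "minor g is (j # js) = Determinant.det A" by (simp add: minor_def A_def n_def len)
  also have "\<dots> = (\<Sum>k<Suc n. A $$ (k, 0) * cofactor A k 0)"
    by (rule laplace_expansion_column[OF A]) simp
  also have "\<dots> = (\<Sum>k<Suc n. (-1)^k * g (is ! k) j * minor g (take k is @ drop (Suc k) is) js)"
  proof (rule sum.cong)
    fix k assume "k \<in> {..<Suc n}"
    then have k: "k < Suc n" by simp
    have l: "length (take k is @ drop (Suc k) is) = n" using k by (simp add: len n_def)
    have "A $$ (k, 0) = g (is ! k) j" using k by (simp add: A_def)
    then show "A $$ (k, 0) * cofactor A k 0 =
        (-1)^k * g (is ! k) j * minor g (take k is @ drop (Suc k) is) js"
      unfolding cofactor_def del[OF k] minor_def l by (simp add: ac_simps)
  qed simp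
  finally show ?thesis by (simp add: n_def len)
qed

lemma minor_3:
  "minor g [i, j, k] [r, s, t] = g i r * (g j s * g k t - g k s * g j t)
   - g j r * (g i s * g k t - g k s * g i t) + g k r * (g i s * g j t - g j s * g i t)"
  by (simp add: minor_expand minor_Nil lessThan_Suc algebra_simps)

text \<open>
  Laplace expansion along the first three columns: expanding one column at a time gives 120 terms,
  and the six that delete the same three rows add up to a product of two complementary minors. The sign
  is the parity of the shuffle that separates the two sets of rows.
\<close>

lemma minor_laplace_6:
  assumes "length js = 3"
  shows "minor g [a, b, c, d, e, f] (r # s # t # js) =
    minor g [a,b,c] [r, s, t] * minor g [d,e,f] js
    - minor g [a,b,d] [r, s, t] * minor g [c,e,f] js
    + minor g [a,b,e] [r, s, t] * minor g [c,d,f] js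
    - minor g [a,b,f] [r, s, t] * minor g [c,d,e] js
    + minor g [a,c,d] [r, s, t] * minor g [b,e,f] js
    - minor g [a,c,e] [r, s, t] * minor g [b,d,f] js
    + minor g [a,c,f] [r, s, t] * minor g [b,d,e] js
    + minor g [a,d,e] [r, s, t] * minor g [b,c,f] js
    - minor g [a,d,f] [r, s, t] * minor g [b,c,e] js
    + minor g [a,e,f] [r, s, t] * minor g [b,c,d] js
    - minor g [b,c,d] [r, s, t] * minor g [a,e,f] js
    + minor g [b,c,e] [r, s, t] * minor g [a,d,f] js
    - minor g [b,c,f] [r, s, t] * minor g [a,d,e] js
    - minor g [b,d,e] [r, s, t] * minor g [a,c,f] js
    + minor g [b,d,f] [r, s, t] * minor g [a,c,e] js
    - minor g [b,e,f] [r, s, t] * minor g [a,c,d] js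
    + minor g [c,d,e] [r, s, t] * minor g [a,b,f] js
    - minor g [c,d,f] [r, s, t] * minor g [a,b,e] js
    + minor g [c,e,f] [r, s, t] * minor g [a,b,d] js
    - minor g [d,e,f] [r, s, t] * minor g [a,b,c] js"
  using assms by (simp add: minor_expand minor_Nil lessThan_Suc algebra_simps)

lemma minor_eq_0_iff:
  fixes g :: "'i \<Rightarrow> 'j \<Rightarrow> 'a::idom"
  assumes len: "length is = length js" and dist: "distinct js"
  shows "minor g is js = 0 \<longleftrightarrow>
    (\<exists>v. (\<exists>j\<in>set js. v j \<noteq> 0) \<and> (\<forall>i\<in>set is. (\<Sum>j\<in>set js. g i j * v j) = 0))"
proof -
  define n where "n = length js"
  have bij: "bij_betw ((!) js) {..<n} (set js)" using dist by (simp add: n_def bij_betw_nth)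
  define f where "f = inv_into {..<n} ((!) js)"
  have f: "f (js ! l) = l" if "l < n" for l
    using bij that by (simp add: f_def bij_betw_def inv_into_f_f)
  have sum_js: "(\<Sum>j\<in>set js. h j) = (\<Sum>l<n. h (js ! l))" for h :: "'j \<Rightarrow> 'a"
    using sum.reindex_bij_betw[OF bij, of h] by simp
  define A where "A = Matrix.mat n n (\<lambda>(k, l). g (is ! k) (js ! l))"
  have A: "A \<in> carrier_mat n n" by (simp add: A_def)
  have "minor g is js = 0 \<longleftrightarrow> Determinant.det A = 0" by (simp add: minor_def A_def n_def len)
  also have "\<dots> \<longleftrightarrow> (\<exists>v. v \<in> carrier_vec n \<and> v \<noteq> 0\<^sub>v n \<and> A *\<^sub>v v = 0\<^sub>v n)"
    by (rule det_0_iff_vec_prod_zero[OF A])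
  also have "\<dots> \<longleftrightarrow> (\<exists>v. (\<exists>j\<in>set js. v j \<noteq> 0) \<and> (\<forall>i\<in>set is. (\<Sum>j\<in>set js. g i j * v j) = 0))"
  proof safe
    fix v assume v: "v \<in> carrier_vec n" "v \<noteq> 0\<^sub>v n" "A *\<^sub>v v = 0\<^sub>v n"
    obtain l where l: "l < n" "vec_index v l \<noteq> 0"
      using v(1,2) by (metis carrier_vecD eq_vecI index_zero_vec)
    have "(\<Sum>l<n. g (is ! k) (js ! l) * vec_index v l) = 0" if "k < n" for k
    proof -
      have "vec_index (A *\<^sub>v v) k = 0" using v(3) that by simp
      then show ?thesis using v(1) that by (simp add: A_def scalar_prod_def lessThan_atLeast0)
    qed
    then have "\<forall>i\<in>set is. (\<Sum>j\<in>set js. g i j * vec_index v (f j)) = 0"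
      by (simp add: sum_js f all_set_conv_all_nth len n_def)
    moreover have "\<exists>j\<in>set js. vec_index v (f j) \<noteq> 0"
      using l by (intro bexI[of _ "js ! l"]) (simp_all add: f n_def)
    ultimately show "\<exists>v. (\<exists>j\<in>set js. v j \<noteq> 0) \<and> (\<forall>i\<in>set is. (\<Sum>j\<in>set js. g i j * v j) = 0)"
      by (intro exI[of _ "\<lambda>j. vec_index v (f j)"]) blast
  next
    fix v j assume v: "\<forall>i\<in>set is. (\<Sum>j\<in>set js. g i j * v j) = 0" and j: "j \<in> set js" "v j \<noteq> 0"
    obtain l where l: "l < n" "v (js ! l) \<noteq> 0" using j by (auto simp: in_set_conv_nth n_def)
    have z: "(\<Sum>l<n. g (is ! k) (js ! l) * v (js ! l)) = 0" if "k < n" for k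
      using v that by (simp add: sum_js n_def len)
    show "\<exists>v. v \<in> carrier_vec n \<and> v \<noteq> 0\<^sub>v n \<and> A *\<^sub>v v = 0\<^sub>v n"
    proof (intro exI[of _ "Matrix.vec n (\<lambda>l. v (js ! l))"] conjI)
      show "Matrix.vec n (\<lambda>l. v (js ! l)) \<noteq> 0\<^sub>v n" using l by (metis index_vec index_zero_vec(1))
      show "A *\<^sub>v Matrix.vec n (\<lambda>l. v (js ! l)) = 0\<^sub>v n"
        by (rule eq_vecI) (use z in \<open>auto simp: A_def scalar_prod_def lessThan_atLeast0\<close>)
    qed simp
  qed
  finally show ?thesis .
qed

section \<open>Rank and linear relations between rows\<close>

lemma rank_le_rows: "rank (A :: 'a::field^'n^'m) \<le> CARD('m)"
proof -
  have rows: "rows A = range (\<lambda>i. row i A)" by (auto simp: rows_def)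
  have "rank A \<le> card (rows A)"
    unfolding row_rank_def_gen by (rule vec.dim_le_card') (simp add: rows)
  also have "\<dots> \<le> CARD('m)" unfolding rows by (rule card_image_le) simp
  finally show ?thesis .
qed

text \<open>
  The rank is the dimension of the span of the \<^emph>\<open>set\<close> of rows, so a repeated row has to be treated
  as a relation of its own.
\<close>

lemma rank_less_iff:
  fixes A :: "'a::field^'n^'m"
  shows "rank A < CARD('m) \<longleftrightarrow> (\<exists>c. (\<exists>i. c i \<noteq> 0) \<and> (\<Sum>i\<in>UNIV. c i *s row i A) = 0)"
proof -
  have rows: "rows A = range (\<lambda>i. row i A)" by (auto simp: rows_def)
  have fin: "finite (rows A)" by (simp add: rows)
  have card: "card (rows A) \<le> CARD('m)" unfolding rows by (rule card_image_le) simp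
  have "rank A = CARD('m) \<longleftrightarrow> inj (\<lambda>i. row i A) \<and> vec.independent (rows A)"
  proof
    assume r: "rank A = CARD('m)"
    have "vec.dim (rows A) \<le> card (rows A)"
      by (rule vec.dim_le_card'[OF fin])
    with r card have c: "card (rows A) = CARD('m)" by (simp add: row_rank_def_gen)
    moreover have "vec.independent (rows A)"
      using c r fin by (metis row_rank_def_gen vec.card_le_dim_spanning vec.span_superset order_refl)
    ultimately show "inj (\<lambda>i. row i A) \<and> vec.independent (rows A)"
      by (metis eq_card_imp_inj_on finite rows)
  next
    assume "inj (\<lambda>i. row i A) \<and> vec.independent (rows A)"
    then show "rank A = CARD('m)"
      by (simp add: row_rank_def_gen vec.dim_eq_card_independent rows card_image)
  qed
  also have "\<dots> \<longleftrightarrow> (\<forall>c. (\<Sum>i\<in>UNIV. c i *s row i A) = 0 \<longrightarrow> (\<forall>i. c i = 0))"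
  proof
    assume "inj (\<lambda>i. row i A) \<and> vec.independent (rows A)"
    then have inj: "inj (\<lambda>i. row i A)" and ind: "vec.independent (rows A)" by auto
    show "\<forall>c. (\<Sum>i\<in>UNIV. c i *s row i A) = 0 \<longrightarrow> (\<forall>i. c i = 0)"
    proof (intro allI impI)
      fix c i assume "(\<Sum>i\<in>UNIV. c i *s row i A) = 0"
      then have "(\<Sum>v\<in>rows A. c (inv_into UNIV (\<lambda>i. row i A) v) *s v) = 0"
        unfolding rows by (simp add: sum.reindex[OF inj] inv_f_f[OF inj])
      then have "c (inv_into UNIV (\<lambda>i. row i A) (row i A)) = 0"
        by (rule vec.independentD[OF ind fin order_refl]) (simp add: rows)
      then show "c i = 0" by (simp add: inv_f_f[OF inj])
    qed
  next
    assume z: "\<forall>c. (\<Sum>i\<in>UNIV. c i *s row i A) = 0 \<longrightarrow> (\<forall>i. c i = 0)"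
    have inj: "inj (\<lambda>i. row i A)"
    proof (rule injI, rule ccontr)
      fix i j assume r: "row i A = row j A" and ij: "i \<noteq> j"
      have "(\<Sum>k\<in>UNIV. (of_bool (k = i) - of_bool (k = j)) *s row k A) = 0"
        by (simp add: vec.scale_left_diff_distrib sum_subtractf of_bool_def if_distrib[of "\<lambda>a. a *s _"] r cong: if_cong)
      then have "of_bool (i = i) - of_bool (i = j) = (0::'a)"
        using z[rule_format, of "\<lambda>k. of_bool (k = i) - of_bool (k = j)" i] by blast
      then show False using ij by simp
    qed
    have "vec.independent (rows A)"
    proof (rule vec.independent_if_scalars_zero[OF fin])
      fix f v assume f: "(\<Sum>v\<in>rows A. f v *s v) = 0" and v: "v \<in> rows A"
      have "(\<Sum>i\<in>UNIV. f (row i A) *s row i A) = 0"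
        using f unfolding rows by (simp add: sum.reindex[OF inj])
      then have "\<forall>i. f (row i A) = 0" by (rule z[THEN spec, THEN mp])
      then show "f v = 0" using v by (auto simp: rows)
    qed
    with inj show "inj (\<lambda>i. row i A) \<and> vec.independent (rows A)" by blast
  qed
  finally have full: "rank A = CARD('m) \<longleftrightarrow> (\<forall>c. (\<Sum>i\<in>UNIV. c i *s row i A) = 0 \<longrightarrow> (\<forall>i. c i = 0))" .
  have "rank A < CARD('m) \<longleftrightarrow> rank A \<noteq> CARD('m)"
    using rank_le_rows[of A] by (simp add: order_less_le)
  then show ?thesis unfolding full by blast
qed

lemma ex_2: "(\<exists>i::2. P i) \<longleftrightarrow> P 1 \<or> P 2"
  by (metis exhaust_2)

lemma rank_2_iff:
  fixes T :: "complex^3^2"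
  shows "rank T = 2 \<longleftrightarrow> (\<forall>a b. a *s (T $ 1) + b *s (T $ 2) = 0 \<longrightarrow> a = 0 \<and> b = 0)"
proof -
  have "rank T < 2 \<longleftrightarrow> (\<exists>c::2\<Rightarrow>complex. (c 1 \<noteq> 0 \<or> c 2 \<noteq> 0) \<and> c 1 *s (T $ 1) + c 2 *s (T $ 2) = 0)"
    using rank_less_iff[of T] by (simp add: ex_2 sum_2 row_def vec_lambda_eta)
  also have "\<dots> \<longleftrightarrow> (\<exists>a b. (a \<noteq> 0 \<or> b \<noteq> 0) \<and> a *s (T $ 1) + b *s (T $ 2) = 0)"
  proof safe
    fix a b assume "a *s (T $ 1) + b *s (T $ 2) = 0" "a \<noteq> 0"
    then show "\<exists>c::2\<Rightarrow>complex. (c 1 \<noteq> 0 \<or> c 2 \<noteq> 0) \<and> c 1 *s (T $ 1) + c 2 *s (T $ 2) = 0"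
      by (intro exI[of _ "\<lambda>i. if i = 1 then a else b"]) simp
  next
    fix a b assume "a *s (T $ 1) + b *s (T $ 2) = 0" "b \<noteq> 0"
    then show "\<exists>c::2\<Rightarrow>complex. (c 1 \<noteq> 0 \<or> c 2 \<noteq> 0) \<and> c 1 *s (T $ 1) + c 2 *s (T $ 2) = 0"
      by (intro exI[of _ "\<lambda>i. if i = 1 then a else b"]) simp
  qed blast+
  finally show ?thesis using rank_le_rows[of T] by (simp add: order_less_le) metis
qed

text \<open>
  The kernel of a projection is spanned by the cross product \<open>n\<close> of its two rows: every kernel vector is
  proportional to \<open>n\<close>, and \<open>n \<noteq> 0\<close> because the rows are independent. So a nonzero kernel vector spans
  the kernel.
\<close>

lemma is_center_of_kernel:
  fixes T :: "complex^3^2"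
  assumes r: "rank T = 2" and x: "T *v x = 0" "x \<noteq> 0"
  shows "is_center T x"
proof -
  define m where "m j k = T $ 1 $ j * T $ 2 $ k - T $ 1 $ k * T $ 2 $ j" for j k :: 3
  obtain j k where jk: "m j k \<noteq> 0"
  proof (rule ccontr)
    assume "\<not> thesis"
    then have m: "m j k = 0" for j k using that by blast
    have T0: "T $ 1 = 0 \<Longrightarrow> False" using r unfolding rank_2_iff by (metis add.right_neutral vec.scale_zero_left vec.scale_zero_right zero_neq_one)
    then obtain k where k: "T $ 1 $ k \<noteq> 0" by (auto simp: vec_eq_iff)
    have "(- T $ 2 $ k) *s (T $ 1) + (T $ 1 $ k) *s (T $ 2) = 0"
      using m[of k] by (simp add: vec_eq_iff m_def algebra_simps)
    then show False using r k unfolding rank_2_iff by blast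
  qed
  define n :: "complex^3" where "n = vector [m 2 3, m 3 1, m 1 2]"
  have "n \<noteq> 0"
    using jk by (cases j rule: exhaust_3[THEN disjE]; cases k rule: exhaust_3[THEN disjE]) (auto simp: n_def vec_eq_iff forall_3 m_def)
  then obtain l where l: "n $ l \<noteq> 0" by (auto simp: vec_eq_iff)
  have par: "v $ j * n $ l = n $ j * v $ l" if v: "T *v v = 0" for v j
  proof -
    have v: "T $ 1 $ 1 * v $ 1 + T $ 1 $ 2 * v $ 2 + T $ 1 $ 3 * v $ 3 = 0"
       "T $ 2 $ 1 * v $ 1 + T $ 2 $ 2 * v $ 2 + T $ 2 $ 3 * v $ 3 = 0"
      using v by (simp_all add: vec_eq_iff forall_2 matrix_vector_mult_def sum_3)
    \<comment> \<open>The entries of \<open>n \<times> v = t\<^sub>2 (t\<^sub>1 \<cdot> v) - t\<^sub>1 (t\<^sub>2 \<cdot> v)\<close> up to sign, for the rows \<open>t\<^sub>1, t\<^sub>2\<close> of \<open>T\<close>.\<close>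
    have "v $ 1 * n $ 2 - n $ 1 * v $ 2 =
        T$1$3 * (T$2$1 * v$1 + T$2$2 * v$2 + T$2$3 * v$3) - T$2$3 * (T$1$1 * v$1 + T$1$2 * v$2 + T$1$3 * v$3)"
      "v $ 1 * n $ 3 - n $ 1 * v $ 3 =
        T$2$2 * (T$1$1 * v$1 + T$1$2 * v$2 + T$1$3 * v$3) - T$1$2 * (T$2$1 * v$1 + T$2$2 * v$2 + T$2$3 * v$3)"
      "v $ 2 * n $ 3 - n $ 2 * v $ 3 =
        T$1$1 * (T$2$1 * v$1 + T$2$2 * v$2 + T$2$3 * v$3) - T$2$1 * (T$1$1 * v$1 + T$1$2 * v$2 + T$1$3 * v$3)"
      unfolding n_def m_def vector_3 by (simp_all add: algebra_simps)
    then have "v $ 1 * n $ 2 = n $ 1 * v $ 2" "v $ 1 * n $ 3 = n $ 1 * v $ 3" "v $ 2 * n $ 3 = n $ 2 * v $ 3"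
      unfolding v by simp_all
    then have "\<forall>j l. v $ j * n $ l = n $ j * v $ l" by (simp add: forall_3 mult.commute)
    then show ?thesis by blast
  qed
  have xl: "x $ l \<noteq> 0"
  proof
    assume "x $ l = 0"
    then have "x $ j = 0" for j using par[OF x(1), of j] l by simp
    then show False using x(2) by (simp add: vec_eq_iff)
  qed
  have "v \<in> vec.span {x}" if v: "T *v v = 0" for v
  proof -
    have "v $ j = v $ l / x $ l * x $ j" for j
    proof -
      have "n $ l * (v $ j * x $ l) = n $ l * (x $ j * v $ l)"
        using arg_cong[OF par[OF v, of j], of "\<lambda>a. a * x $ l"] arg_cong[OF par[OF x(1), of j], of "\<lambda>a. a * v $ l"]
        by (simp only: ac_simps)
      then have "v $ j * x $ l = x $ j * v $ l" using l by simp
      then show ?thesis using xl by (simp add: field_simps)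
    qed
    then have "v = (v $ l / x $ l) *s x" unfolding vec_eq_iff vector_smult_component by blast
    moreover have "(v $ l / x $ l) *s x \<in> vec.span {x}"
      by (intro vec.span_scale vec.span_base) simp
    ultimately show ?thesis by simp
  qed
  moreover have "T *v v = 0" if "v \<in> vec.span {x}" for v
    using that x(1) by (auto simp: vec.span_singleton vec.scale)
  ultimately show ?thesis unfolding is_center_def by blast
qed

section \<open>Brackets of six points in the plane\<close>

text \<open>
  The Grassmann-Pluecker exchange relation, Cramer's rule for four vectors of \<open>\<complex>\<^sup>3\<close>.
\<close>

lemma br3_exchange:
  "br3 p a b c * br3 p d e f =
   br3 p d b c * br3 p a e f + br3 p e b c * br3 p d a f + br3 p f b c * br3 p d e a"
  unfolding br3_def det_3 vector_3 by (simp add: algebra_simps)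

text \<open>
  As \<open>6 = 0\<close> in the index type, its order is \<open>6 < 1 < 2 < 3 < 4 < 5\<close>. The guards in \<open>br3_sort\<close> turn
  antisymmetry into terminating rewrite rules that sort the entries of every bracket.
\<close>

lemma less_6: "(6::6) < 1" "(6::6) < 2" "(6::6) < 3" "(6::6) < 4" "(6::6) < 5"
  "(1::6) < 2" "(1::6) < 3" "(1::6) < 4" "(1::6) < 5"
  "(2::6) < 3" "(2::6) < 4" "(2::6) < 5" "(3::6) < 4" "(3::6) < 5" "(4::6) < 5"
  by (simp_all add: less_bit0_def bit0.Rep_numeral bit0.Rep_1)

lemma br3_sort:
  "j < i \<Longrightarrow> br3 p i j k = - br3 p j i k"
  "k < j \<Longrightarrow> br3 p i j k = - br3 p i k j"
  unfolding br3_def det_3 vector_3 by (simp_all add: algebra_simps)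

lemmas sort_simps = br3_sort less_6

definition br3_pair :: "(6 \<Rightarrow> complex^3) \<Rightarrow> 6 \<Rightarrow> 6 \<Rightarrow> 6 \<Rightarrow> 6 \<Rightarrow> 6 \<Rightarrow> 6 \<Rightarrow> complex"
  where "br3_pair p i j k l m n = br3 p i j k * br3 p l m n"

text \<open>
  Index 6 is the least, so once all brackets are sorted it stands in front of the bracket that
  contains it; these rules collect two complementary brackets with that one first.
\<close>

lemma br3_pair_fold:
  "br3 p 6 i j * br3 p k l m = br3_pair p 6 i j k l m"
  "k < l \<Longrightarrow> l < m \<Longrightarrow> 6 < k \<Longrightarrow> br3 p k l m * br3 p 6 i j = br3_pair p 6 i j k l m"
  by (simp_all add: br3_pair_def)

lemma br3_pair_fold_scaled:
  "a * br3 p 6 i j * (b * br3 p k l m) = a * b * br3_pair p 6 i j k l m"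
  "k < l \<Longrightarrow> l < m \<Longrightarrow> 6 < k \<Longrightarrow> a * br3 p k l m * (b * br3 p 6 i j) = a * b * br3_pair p 6 i j k l m"
  by (simp_all add: br3_pair_def)

text \<open>
  Of the ten products of complementary brackets the five standard ones, where \<open>[ijk][lmn]\<close> has
  \<open>i < l\<close>, \<open>j < m\<close> and \<open>k < n\<close> in the order \<open>6 < 1 < \<dots> < 5\<close>, generate the others. Each relation
  exchanges one vector of the first bracket for those of the second, chosen so that the right-hand
  side contains standard products or products that have been straightened before.
\<close>

lemma br3_pair_straighten:
  "br3_pair p 6 1 5 2 3 4 = br3_pair p 6 1 2 3 4 5 - br3_pair p 6 1 3 2 4 5 + br3_pair p 6 1 4 2 3 5"
  "br3_pair p 6 2 5 1 3 4 = br3_pair p 6 2 4 1 3 5 - br3_pair p 6 2 3 1 4 5 - br3_pair p 6 1 2 3 4 5"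
  "br3_pair p 6 3 4 1 2 5 = br3_pair p 6 2 4 1 3 5 - br3_pair p 6 2 3 1 4 5 - br3_pair p 6 1 4 2 3 5 + br3_pair p 6 1 3 2 4 5 - br3_pair p 6 1 2 3 4 5"
  "br3_pair p 6 3 5 1 2 4 = br3_pair p 6 2 4 1 3 5 - br3_pair p 6 1 4 2 3 5 - br3_pair p 6 1 2 3 4 5"
  "br3_pair p 6 4 5 1 2 3 = br3_pair p 6 2 3 1 4 5 - br3_pair p 6 1 3 2 4 5 + br3_pair p 6 1 2 3 4 5"
proof -
  show 1: "br3_pair p 6 1 5 2 3 4 = br3_pair p 6 1 2 3 4 5 - br3_pair p 6 1 3 2 4 5 + br3_pair p 6 1 4 2 3 5"
    using br3_exchange[of p 5 6 1 2 3 4] by (simp add: sort_simps br3_pair_def algebra_simps)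
  show 2: "br3_pair p 6 2 5 1 3 4 = br3_pair p 6 2 4 1 3 5 - br3_pair p 6 2 3 1 4 5 - br3_pair p 6 1 2 3 4 5"
    using br3_exchange[of p 5 6 2 1 3 4] by (simp add: sort_simps br3_pair_def algebra_simps)
  have 3: "br3_pair p 6 3 4 1 2 5 = br3_pair p 6 2 5 1 3 4 - br3_pair p 6 1 5 2 3 4 + br3_pair p 6 1 2 3 4 5"
    using br3_exchange[of p 6 3 4 1 2 5] by (simp add: sort_simps br3_pair_def algebra_simps)
  show "br3_pair p 6 3 4 1 2 5 = br3_pair p 6 2 4 1 3 5 - br3_pair p 6 2 3 1 4 5 - br3_pair p 6 1 4 2 3 5 + br3_pair p 6 1 3 2 4 5 - br3_pair p 6 1 2 3 4 5"
    by (simp add: 1 2 3)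
  show "br3_pair p 6 3 5 1 2 4 = br3_pair p 6 2 4 1 3 5 - br3_pair p 6 1 4 2 3 5 - br3_pair p 6 1 2 3 4 5"
    using br3_exchange[of p 6 3 5 1 2 4] by (simp add: sort_simps br3_pair_def algebra_simps)
  show "br3_pair p 6 4 5 1 2 3 = br3_pair p 6 2 3 1 4 5 - br3_pair p 6 1 3 2 4 5 + br3_pair p 6 1 2 3 4 5"
    using br3_exchange[of p 6 4 5 1 2 3] by (simp add: sort_simps br3_pair_def algebra_simps)
qed

lemma bar_standard:
  "bar_a p = 6 * br3_pair p 6 1 2 3 4 5 - 4 * br3_pair p 6 1 3 2 4 5 + 2 * br3_pair p 6 1 4 2 3 5 + 2 * br3_pair p 6 2 3 1 4 5 - 4 * br3_pair p 6 2 4 1 3 5"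
  "bar_b p = 2 * br3_pair p 6 1 3 2 4 5 - 4 * br3_pair p 6 1 4 2 3 5 + 2 * br3_pair p 6 2 3 1 4 5 + 2 * br3_pair p 6 2 4 1 3 5"
  "bar_c p = - 4 * br3_pair p 6 1 3 2 4 5 + 2 * br3_pair p 6 1 4 2 3 5 + 2 * br3_pair p 6 2 3 1 4 5 + 2 * br3_pair p 6 2 4 1 3 5"
  "bar_d p = - 6 * br3_pair p 6 1 2 3 4 5 + 2 * br3_pair p 6 1 3 2 4 5 - 4 * br3_pair p 6 1 4 2 3 5 - 4 * br3_pair p 6 2 3 1 4 5 + 2 * br3_pair p 6 2 4 1 3 5"
  "bar_e p = 2 * br3_pair p 6 1 3 2 4 5 + 2 * br3_pair p 6 1 4 2 3 5 + 2 * br3_pair p 6 2 3 1 4 5 - 4 * br3_pair p 6 2 4 1 3 5"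
  "bar_f p = 2 * br3_pair p 6 1 3 2 4 5 + 2 * br3_pair p 6 1 4 2 3 5 - 4 * br3_pair p 6 2 3 1 4 5 + 2 * br3_pair p 6 2 4 1 3 5"
  by (simp_all only: bar_a_def bar_b_def bar_c_def bar_d_def bar_e_def bar_f_def br33_def
      sort_simps mult_minus_left mult_minus_right minus_minus br3_pair_fold br3_pair_straighten[of p]) (simp_all add: algebra_simps)

section \<open>The determinant and the Joubert invariants\<close>

text \<open>
  The columns are indexed by the pairs of \<open>2 \<times> 3\<close> with the factor of \<open>u i\<close> in front, so that the first
  three columns are those with a common factor \<open>u i $ 1\<close>.
\<close>

abbreviation kron_entry :: "(6 \<Rightarrow> complex^3) \<Rightarrow> (6 \<Rightarrow> complex^2) \<Rightarrow> 6 \<Rightarrow> 2 \<times> 3 \<Rightarrow> complex"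
  where "kron_entry x u \<equiv> \<lambda>i (j, k). u i $ j * x i $ k"

abbreviation kron_det :: "(6 \<Rightarrow> complex^3) \<Rightarrow> (6 \<Rightarrow> complex^2) \<Rightarrow> complex"
  where "kron_det x u \<equiv> minor (kron_entry x u) [1,2,3,4,5,6] [(1,1),(1,2),(1,3),(2,1),(2,2),(2,3)]"

lemma kron_block_minor:
  "minor (kron_entry x u) [i, j, k] [(r,1),(r,2),(r,3)] = u i $ r * u j $ r * u k $ r * br3 x i j k"
  unfolding minor_3 br3_def det_3 vector_3 by (simp add: algebra_simps)

text \<open>
  Sorting and straightening the twenty terms of the Laplace expansion leaves the five standard
  products. Each of their coefficients has at most twelve monomials and factors as written: every
  product of three brackets pairs up the six points \<open>u i\<close>.
\<close>

lemma kron_det_standard: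
  "kron_det x u =
     - (br2 u 6 1 * br2 u 2 3 * br2 u 4 5 + br2 u 6 3 * br2 u 1 4 * br2 u 2 5) * br3_pair x 6 1 2 3 4 5
     + br2 u 6 2 * br2 u 1 4 * br2 u 3 5 * br3_pair x 6 1 3 2 4 5
     - br2 u 6 2 * br2 u 1 3 * br2 u 4 5 * br3_pair x 6 1 4 2 3 5
     - br2 u 6 1 * br2 u 2 4 * br2 u 3 5 * br3_pair x 6 2 3 1 4 5
     + br2 u 6 1 * br2 u 2 3 * br2 u 4 5 * br3_pair x 6 2 4 1 3 5"
  apply (subst minor_laplace_6)
   apply simp
  apply (simp only: kron_block_minor sort_simps mult_minus_left mult_minus_right minus_minus br3_pair_fold_scaled br3_pair_straighten[of x] br2_def det_2 vector_2)
  apply (simp add: algebra_simps)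
  done

text \<open>
  Writing the six \<open>bar\<close> forms in the five standard products gives a \<open>6 \<times> 5\<close> matrix of integers
  (see \<open>bar_standard\<close>). The coefficients on the left-hand sides are its columns, divided by
  \<open>6, 2, 2, 2, 2\<close>; the right-hand sides are the coefficients in \<open>kron_det_standard\<close>, times 24 and
  divided by the same numbers.
\<close>

lemma joubert_dual:
  "joubert_A u - joubert_D u = - 4 * (br2 u 6 1 * br2 u 2 3 * br2 u 4 5 + br2 u 6 3 * br2 u 1 4 * br2 u 2 5)"
  "- 2 * joubert_A u + joubert_B u - 2 * joubert_C u + joubert_D u + joubert_E u + joubert_F u
    = 12 * (br2 u 6 2 * br2 u 1 4 * br2 u 3 5)"
  "joubert_A u - 2 * joubert_B u + joubert_C u - 2 * joubert_D u + joubert_E u + joubert_F u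
    = - 12 * (br2 u 6 2 * br2 u 1 3 * br2 u 4 5)"
  "joubert_A u + joubert_B u + joubert_C u - 2 * joubert_D u + joubert_E u - 2 * joubert_F u
    = - 12 * (br2 u 6 1 * br2 u 2 4 * br2 u 3 5)"
  "- 2 * joubert_A u + joubert_B u + joubert_C u + joubert_D u - 2 * joubert_E u + joubert_F u
    = 12 * (br2 u 6 1 * br2 u 2 3 * br2 u 4 5)"
  unfolding joubert_A_def joubert_B_def joubert_C_def joubert_D_def joubert_E_def joubert_F_def br2_def det_2 vector_2
  by (simp_all add: algebra_simps)

lemma bar_joubert_sum_eq:
  "bar_a x * joubert_A u + bar_b x * joubert_B u + bar_c x * joubert_C u
      + bar_d x * joubert_D u + bar_e x * joubert_E u + bar_f x * joubert_F u
    = 24 * kron_det x u"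
proof -
  have "bar_a x * joubert_A u + bar_b x * joubert_B u + bar_c x * joubert_C u
      + bar_d x * joubert_D u + bar_e x * joubert_E u + bar_f x * joubert_F u =
    6 * br3_pair x 6 1 2 3 4 5 * (joubert_A u - joubert_D u)
    + 2 * br3_pair x 6 1 3 2 4 5 * (- 2 * joubert_A u + joubert_B u - 2 * joubert_C u + joubert_D u + joubert_E u + joubert_F u)
    + 2 * br3_pair x 6 1 4 2 3 5 * (joubert_A u - 2 * joubert_B u + joubert_C u - 2 * joubert_D u + joubert_E u + joubert_F u)
    + 2 * br3_pair x 6 2 3 1 4 5 * (joubert_A u + joubert_B u + joubert_C u - 2 * joubert_D u + joubert_E u - 2 * joubert_F u)
    + 2 * br3_pair x 6 2 4 1 3 5 * (- 2 * joubert_A u + joubert_B u + joubert_C u + joubert_D u - 2 * joubert_E u + joubert_F u)"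
    unfolding bar_standard by (simp add: algebra_simps)
  also have "\<dots> = 24 * kron_det x u"
    unfolding joubert_dual kron_det_standard by (simp add: algebra_simps)
  finally show ?thesis .
qed

section \<open>Left kernel: rank deficiency of Z\<close>

lemma UNIV_6: "(UNIV::6 set) = {1,2,3,4,5,6}"
  by (rule sym, rule card_subset_eq) simp_all

lemma kron_det_eq_0_iff_rows:
  "kron_det x u = 0 \<longleftrightarrow>
    (\<exists>c. (\<exists>i. c i \<noteq> 0) \<and> (\<forall>j k. (\<Sum>i\<in>UNIV. c i * (u i $ j * x i $ k)) = 0))"
proof -
  have "kron_det x u = 0 \<longleftrightarrow> (\<exists>c. (\<exists>i\<in>UNIV. c i \<noteq> 0) \<and>
     (\<forall>jk\<in>{(1,1),(1,2),(1,3),(2,1),(2,2),(2,3)}. (\<Sum>i\<in>UNIV. kron_entry x u i jk * c i) = 0))"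
    unfolding UNIV_6 by (subst minor_swap, simp, subst minor_eq_0_iff) simp_all
  then show ?thesis by (simp add: forall_2 forall_3 mult.commute conj_assoc)
qed

lemma line_homographyD:
  assumes "line_homography w H"
  shows "v \<in> line w \<Longrightarrow> (H *v v) $ 3 = 0" and "H *v v = 0 \<longleftrightarrow> v = 0"
  using assms unfolding line_homography_def
  by (blast, metis invertible_def matrix_left_invertible_ker matrix_vector_mult_0_right)

text \<open>
  A linear relation between the rows of \<open>Z\<close> says that three combinations of the \<open>y i\<close>, one for each
  coordinate of the \<open>x i\<close>, vanish. The homography preserves this, and it makes the third
  coordinate vanish for every combination, so only the conditions on the coordinates of \<open>u i\<close> remain.
\<close>

lemma rank_Z_less_iff:
  assumes y: "\<And>i. y i \<in> line w" and H: "line_homography w H" and u: "\<And>i. u i = to_P1 H (y i)"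
  shows "rank (Z_matrix x y) < 6 \<longleftrightarrow> kron_det x u = 0"
proof -
  note ker = line_homographyD(2)[OF H]
  have 3: "(H *v y i) $ 3 = 0" for i using line_homographyD(1)[OF H] y by blast
  have eq: "(\<Sum>i\<in>UNIV. c i *s row i (Z_matrix x y)) = 0 \<longleftrightarrow>
      (\<forall>j k. (\<Sum>i\<in>UNIV. c i * (u i $ j * x i $ k)) = 0)" for c
  proof -
    define v where "v k = (\<Sum>i\<in>UNIV. (c i * x i $ k) *s y i)" for k
    have "(\<Sum>i\<in>UNIV. c i *s row i (Z_matrix x y)) = 0 \<longleftrightarrow> (\<forall>k. v k = 0)"
      by (auto simp: vec_eq_iff v_def row_def Z_matrix_def kronecker_def sum_component mult.assoc)
    also have "\<dots> \<longleftrightarrow> (\<forall>k. H *v v k = 0)" using ker by blast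
    also have "\<dots> \<longleftrightarrow> (\<forall>j k. (\<Sum>i\<in>UNIV. c i * (u i $ j * x i $ k)) = 0)"
    proof -
      have Hv: "(H *v v k) $ j = (\<Sum>i\<in>UNIV. c i * ((H *v y i) $ j * x i $ k))" for j k
        by (simp add: v_def vec.linear_sum[OF matrix_vector_mul_linear_gen] vec.scale sum_component ac_simps)
      show ?thesis
        by (auto simp: vec_eq_iff forall_2 forall_3 Hv 3 u to_P1_def)
    qed
    finally show ?thesis .
  qed
  show ?thesis
    using rank_less_iff[of "Z_matrix x y"] unfolding eq kron_det_eq_0_iff_rows by simp
qed

section \<open>Right kernel: projections to the line\<close>

text \<open>
  The kernel vector and \<open>T\<close> correspond by \<open>v (1, k) = T $ 2 $ k\<close> and \<open>v (2, k) = - T $ 1 $ k\<close>. The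
  condition on \<open>T\<close> is the vanishing of the determinant of \<open>u i\<close> and \<open>T *v x i\<close>.
\<close>

lemma kron_det_eq_0_iff_columns:
  "kron_det x u = 0 \<longleftrightarrow>
    (\<exists>T :: complex^3^2. T \<noteq> 0 \<and> (\<forall>i. u i $ 1 * (T *v x i) $ 2 = u i $ 2 * (T *v x i) $ 1))"
proof -
  have "kron_det x u = 0 \<longleftrightarrow> (\<exists>v :: 2 \<times> 3 \<Rightarrow> complex. (\<exists>jk\<in>{(1,1),(1,2),(1,3),(2,1),(2,2),(2,3)}. v jk \<noteq> 0) \<and>
     (\<forall>i\<in>UNIV. (\<Sum>jk\<in>{(1,1),(1,2),(1,3),(2,1),(2,2),(2,3)}. kron_entry x u i jk * v jk) = 0))"
    unfolding UNIV_6 by (subst minor_eq_0_iff) simp_all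
  also have "\<dots> \<longleftrightarrow> (\<exists>v :: 2 \<times> 3 \<Rightarrow> complex. (\<exists>jk\<in>{(1,1),(1,2),(1,3),(2,1),(2,2),(2,3)}. v jk \<noteq> 0) \<and>
     (\<forall>i. u i $ 1 * (x i $ 1 * v (1,1) + x i $ 2 * v (1,2) + x i $ 3 * v (1,3))
        + u i $ 2 * (x i $ 1 * v (2,1) + x i $ 2 * v (2,2) + x i $ 3 * v (2,3)) = 0))"
    by (simp add: algebra_simps)
  also have "\<dots> \<longleftrightarrow> (\<exists>T :: complex^3^2. T \<noteq> 0 \<and> (\<forall>i. u i $ 1 * (T *v x i) $ 2 = u i $ 2 * (T *v x i) $ 1))"
  proof (intro iffI; elim exE conjE)
    fix v :: "2 \<times> 3 \<Rightarrow> complex"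
    assume ex: "\<exists>jk\<in>{(1,1),(1,2),(1,3),(2,1),(2,2),(2,3)}. v jk \<noteq> 0"
      and v: "\<forall>i. u i $ 1 * (x i $ 1 * v (1,1) + x i $ 2 * v (1,2) + x i $ 3 * v (1,3))
        + u i $ 2 * (x i $ 1 * v (2,1) + x i $ 2 * v (2,2) + x i $ 3 * v (2,3)) = 0"
    define T :: "complex^3^2" where "T = (\<chi> j k. if j = 1 then - v (2,k) else v (1,k))"
    have "T \<noteq> 0" using ex by (auto simp: T_def vec_eq_iff forall_2 forall_3)
    moreover have "u i $ 1 * (T *v x i) $ 2 = u i $ 2 * (T *v x i) $ 1" for i
      using v[rule_format, of i] by (simp add: T_def matrix_vector_mult_def sum_3 algebra_simps eq_neg_iff_add_eq_0)
    ultimately show "\<exists>T :: complex^3^2. T \<noteq> 0 \<and> (\<forall>i. u i $ 1 * (T *v x i) $ 2 = u i $ 2 * (T *v x i) $ 1)" by blast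
  next
    fix T :: "complex^3^2" assume T: "T \<noteq> 0" "\<forall>i. u i $ 1 * (T *v x i) $ 2 = u i $ 2 * (T *v x i) $ 1"
    define v :: "2 \<times> 3 \<Rightarrow> complex" where "v = (\<lambda>(j,k). if j = 1 then T $ 2 $ k else - T $ 1 $ k)"
    have "\<exists>jk\<in>{(1,1),(1,2),(1,3),(2,1),(2,2),(2,3)}. v jk \<noteq> 0"
      using T(1) by (auto simp: v_def vec_eq_iff forall_2 forall_3)
    moreover have "u i $ 1 * (x i $ 1 * v (1,1) + x i $ 2 * v (1,2) + x i $ 3 * v (1,3))
        + u i $ 2 * (x i $ 1 * v (2,1) + x i $ 2 * v (2,2) + x i $ 3 * v (2,3)) = 0" for i
      using T(2)[rule_format, of i] by (simp add: v_def matrix_vector_mult_def sum_3 algebra_simps)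
    ultimately show "\<exists>v :: 2 \<times> 3 \<Rightarrow> complex. (\<exists>jk\<in>{(1,1),(1,2),(1,3),(2,1),(2,2),(2,3)}. v jk \<noteq> 0) \<and>
     (\<forall>i. u i $ 1 * (x i $ 1 * v (1,1) + x i $ 2 * v (1,2) + x i $ 3 * v (1,3))
        + u i $ 2 * (x i $ 1 * v (2,1) + x i $ 2 * v (2,2) + x i $ 3 * v (2,3)) = 0)" by blast
  qed
  finally show ?thesis .
qed

text \<open>
  The homography is injective and makes the third coordinates vanish, so a proportionality between
  \<open>u i\<close> and \<open>u j\<close> lifts to one between \<open>y i\<close> and \<open>y j\<close>.
\<close>

lemma br2_nonzero:
  assumes y: "\<And>i. y i \<noteq> 0" "\<And>i. y i \<in> line w" and H: "line_homography w H"
    and u: "\<And>i. u i = to_P1 H (y i)" and ne: "\<not> y i \<sim>\<^sub>P y j"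
  shows "br2 u i j \<noteq> 0"
proof
  assume "br2 u i j = 0"
  note ker = line_homographyD(2)[OF H]
  have 3: "(H *v y i) $ 3 = 0" for i using line_homographyD(1)[OF H] y by blast
  have u': "u i $ 1 = (H *v y i) $ 1" "u i $ 2 = (H *v y i) $ 2" for i
    by (simp_all add: u to_P1_def)
  have det: "u i $ 1 * u j $ 2 = u i $ 2 * u j $ 1"
    using \<open>br2 u i j = 0\<close> by (simp add: br2_def det_2)
  have nz: "\<exists>k. u i $ k \<noteq> 0" for i
    using y(1)[of i] ker[of "y i"] 3[of i] by (auto simp: vec_eq_iff forall_3 u'[symmetric])
  obtain k where k: "u j $ k \<noteq> 0" using nz by blast
  have "H *v (u j $ k *s y i - u i $ k *s y j) = 0"
    using det k exhaust_2[of k]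
    by (auto simp: vec_eq_iff forall_3 3 u'[symmetric] matrix_vector_mult_diff_distrib vec.scale mult.commute)
  then have e: "u j $ k *s y i = u i $ k *s y j" using ker by (metis right_minus_eq)
  then have e2: "y i = (u i $ k / u j $ k) *s y j" using k
    by (simp add: vec_eq_iff field_simps)
  then have "u i $ k \<noteq> 0" using y(1)[of i] by auto
  with e2 k ne show False unfolding proj_eq_def by (metis divide_eq_0_iff)
qed

text \<open>
  Rank 1 is excluded by counting. At most one \<open>x i\<close> has a nonzero image, since the image of \<open>T\<close> is a
  single point of the projective line; the others lie on the line given by a nonzero row of \<open>T\<close>, and
  general position allows two of them. That accounts for three of the six points. In the other
  direction, if one of the \<open>x i\<close> is the center, then it is mapped to \<open>0\<close>, which satisfies the
  condition of \<open>kron_det_eq_0_iff_columns\<close> as well.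
\<close>

lemma kron_det_eq_0_iff_projection:
  assumes gp: "general_position x" and x: "\<And>i. x i \<noteq> 0" and u: "\<And>i j. i \<noteq> j \<Longrightarrow> br2 u i j \<noteq> 0"
  shows "kron_det x u = 0 \<longleftrightarrow> (\<exists>T. projection T \<and> maps_points T x u)"
proof
  assume "kron_det x u = 0"
  then obtain T :: "complex^3^2" where "T \<noteq> 0"
    and inc: "\<And>i. u i $ 1 * (T *v x i) $ 2 = u i $ 2 * (T *v x i) $ 1"
    unfolding kron_det_eq_0_iff_columns by blast
  then obtain r where r: "T $ r \<noteq> 0" by (auto simp: vec_eq_iff)
  have rank: "rank T = 2"
  proof (rule ccontr)
    assume "rank T \<noteq> 2"
    then obtain a b where ab: "a \<noteq> 0 \<or> b \<noteq> 0" and rel: "a *s (T $ 1) + b *s (T $ 2) = 0"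
      unfolding rank_2_iff by blast
    have img: "a * (T *v v) $ 1 + b * (T *v v) $ 2 = 0" for v
    proof -
      have "a * (T *v v) $ 1 + b * (T *v v) $ 2 = (\<Sum>k\<in>UNIV. (a *s (T $ 1) + b *s (T $ 2)) $ k * v $ k)"
        by (simp add: matrix_vector_mult_def sum_distrib_left sum.distrib algebra_simps)
      then show ?thesis by (simp add: rel)
    qed
    \<comment> \<open>\<open>T x\<^sub>i\<close> and \<open>u\<^sub>i\<close> are proportional, so \<open>u\<^sub>i\<close> satisfies the equation of the image of \<open>T\<close>.\<close>
    have on_image: "a * u i $ 1 + b * u i $ 2 = 0" if "T *v x i \<noteq> 0" for i
    proof -
      have "(a * u i $ 1 + b * u i $ 2) * (T *v x i) $ 1 = u i $ 1 * (a * (T *v x i) $ 1 + b * (T *v x i) $ 2)"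
        "(a * u i $ 1 + b * u i $ 2) * (T *v x i) $ 2 = u i $ 2 * (a * (T *v x i) $ 1 + b * (T *v x i) $ 2)"
        using inc[of i] by (simp_all add: algebra_simps)
      then show ?thesis using that unfolding img by (auto simp: vec_eq_iff forall_2)
    qed
    \<comment> \<open>The image equation determines a point of the line, so two \<open>u\<^sub>i\<close> on it coincide.\<close>
    have "i = j" if "T *v x i \<noteq> 0" "T *v x j \<noteq> 0" for i j
    proof (rule ccontr)
      assume "i \<noteq> j"
      have e: "a * br2 u i j = (a * u i $ 1 + b * u i $ 2) * u j $ 2 - (a * u j $ 1 + b * u j $ 2) * u i $ 2"
       "b * br2 u i j = (a * u j $ 1 + b * u j $ 2) * u i $ 1 - (a * u i $ 1 + b * u i $ 2) * u j $ 1"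
        by (simp_all add: br2_def det_2 algebra_simps)
      then have "br2 u i j = 0" using ab unfolding on_image[OF that(1)] on_image[OF that(2)] by auto
      then show False using u[OF \<open>i \<noteq> j\<close>] by simp
    qed
    then have le1: "card {i. T *v x i \<noteq> 0} \<le> 1" by (simp add: card_le_Suc0_iff_eq)
    have "{i. T *v x i = 0} \<subseteq> {i. x i \<in> line (T $ r)}"
      by (auto simp: line_def dotp_def matrix_vector_mult_def vec_eq_iff)
    then have "card {i. T *v x i = 0} \<le> card {i. x i \<in> line (T $ r)}" by (intro card_mono) simp_all
    also have "\<dots> \<le> 2" using gp r unfolding general_position_def by blast
    finally have le2: "card {i. T *v x i = 0} \<le> 2" .
    have "{i. T *v x i = 0} \<union> {i. T *v x i \<noteq> 0} = UNIV" by auto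
    then have "CARD(6) \<le> card {i. T *v x i = 0} + card {i. T *v x i \<noteq> 0}"
      by (metis card_Un_le)
    then show False using le1 le2 by simp
  qed
  have "T *v x i \<sim>\<^sub>P u i" if "\<not> is_center T (x i)" for i
  proof -
    have nz: "T *v x i \<noteq> 0" using that is_center_of_kernel[OF rank _ x] by blast
    obtain j where "j \<noteq> i" by (metis zero_neq_one)
    then have "\<not> (u i $ 1 = 0 \<and> u i $ 2 = 0)" using u[of i j] by (auto simp: br2_def det_2)
    then obtain k where k: "u i $ k \<noteq> 0" by blast
    have "(T *v x i) $ l * u i $ k = (T *v x i) $ k * u i $ l" for l
      using inc[of i] exhaust_2[of l] exhaust_2[of k] by (auto simp: mult.commute)
    then have e: "T *v x i = ((T *v x i) $ k / u i $ k) *s u i"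
      unfolding vec_eq_iff vector_smult_component using k by (simp add: field_simps)
    have "(T *v x i) $ k / u i $ k \<noteq> 0" using nz e by (metis vec.scale_zero_left)
    then show ?thesis using e unfolding proj_eq_def by blast
  qed
  then show "\<exists>T. projection T \<and> maps_points T x u"
    using rank unfolding projection_def maps_points_def by blast
next
  assume "\<exists>T. projection T \<and> maps_points T x u"
  then obtain T where rank: "rank T = 2" and maps: "maps_points T x u"
    unfolding projection_def by blast
  have "T \<noteq> 0"
  proof
    assume "T = 0"
    then have "1 *s (T $ 1) + 0 *s (T $ 2) = 0" by simp
    then show False using rank unfolding rank_2_iff by (metis zero_neq_one)
  qed
  moreover have "u i $ 1 * (T *v x i) $ 2 = u i $ 2 * (T *v x i) $ 1" for i
  proof (cases "is_center T (x i)")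
    case True
    then have "T *v x i = 0" unfolding is_center_def using vec.span_base[of "x i" "{x i}"] by auto
    then show ?thesis by simp
  next
    case False
    then obtain c where "T *v x i = c *s u i" using maps unfolding maps_points_def proj_eq_def by blast
    then show ?thesis by simp
  qed
  ultimately show "kron_det x u = 0" unfolding kron_det_eq_0_iff_columns by blast
qed

theorem theorem6p8:
  fixes x y :: "6 \<Rightarrow> complex^3" and w :: "complex^3" and H :: "complex^3^3"
    and u :: "6 \<Rightarrow> complex^2"
  assumes x_points: "\<And>i. x i \<noteq> 0"
    and y_points: "\<And>i. y i \<noteq> 0"
    and w_line: "w \<noteq> 0"
    and y_in_line: "\<And>i. y i \<in> line w"
    and homography: "line_homography w H"
    and u_def: "\<And>i. u i = to_P1 H (y i)"
  shows "(rank (Z_matrix x y) < 6 \<longleftrightarrow>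
      bar_a x * joubert_A u + bar_b x * joubert_B u + bar_c x * joubert_C u
      + bar_d x * joubert_D u + bar_e x * joubert_E u + bar_f x * joubert_F u = 0) \<and>
    (general_position x \<and> (\<forall>i j. i \<noteq> j \<longrightarrow> \<not> y i \<sim>\<^sub>P y j) \<longrightarrow>
      (bar_a x * joubert_A u + bar_b x * joubert_B u + bar_c x * joubert_C u
       + bar_d x * joubert_D u + bar_e x * joubert_E u + bar_f x * joubert_F u = 0 \<longleftrightarrow>
       (\<exists>T. projection T \<and> maps_points T x u)))"
proof -
  have "rank (Z_matrix x y) < 6 \<longleftrightarrow> kron_det x u = 0"
    by (rule rank_Z_less_iff[OF y_in_line homography u_def])
  moreover have "kron_det x u = 0 \<longleftrightarrow> (\<exists>T. projection T \<and> maps_points T x u)"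
    if "general_position x" and distinct: "\<forall>i j. i \<noteq> j \<longrightarrow> \<not> y i \<sim>\<^sub>P y j"
    using that br2_nonzero[OF y_points y_in_line homography u_def]
    by (intro kron_det_eq_0_iff_projection x_points) auto
  ultimately show ?thesis unfolding bar_joubert_sum_eq by simp
qed

end
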